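(* Let $k\ge1$, $\eta>0$, and let $A=\operatorname{diag}(\lambda_1,\dots,\lambda_k)\in\mathbb R^{k\times k}$ have distinct diagonal entries with $|\lambda_i|\ge1+\eta$ for every $i\in\{1,\dots,k\}$. Let $B=(b_1,\dots,b_k)^\top\in\mathbb R^{k\times1}$ with $b_i\ne0$ for every $i$. Consider the scalar-input system $$x_t=Ax_{t-1}+Bu_t\quad(t\ge1),\qquad x_0=0.$$ If a nonzero real input sequence $u=(u_t)_{t\ge1}$ stabilizes the system, i.e. $\lim_{t\to\infty}\|x_t\|_2=0$, then $$\mathrm{IDR}(u)\ \ge\ \frac{\eta}{2(1+\eta)}\Bigl(1+\frac\eta2\Bigr)^{k}.$$ In particular, every nonzero stabilizing input has input dynamic range growing exponentially in $k$.
   Context: For a nonzero input sequence $u=(u_t)_{t\ge1}$ of reals, its (input) dynamic range is $$\mathrm{IDR}(u):=\frac{\sup_{t\ge1}|u_t|}{\inf\{|u_t|:u_t\neq0\}},$$ with the convention $\mathrm{IDR}(u)=\infty$ when $\inf\{|u_t|:u_t\ne0\}=0$. *)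

theory Defs
  imports
    "HOL-Library.Extended_Real"
    "HOL-Analysis.L2_Norm"
    "Jordan_Normal_Form.Matrix"
begin

text \<open>Input sequences are functions on \<open>nat\<close> of which only the values at times \<open>t \<ge> 1\<close> matter;
  the value at \<open>0\<close> is ignored by every definition below.\<close>

definition nonzero_input :: "(nat \<Rightarrow> real) \<Rightarrow> bool" where
  "nonzero_input u \<longleftrightarrow> (\<exists>t\<ge>1. u t \<noteq> 0)"

text \<open>The range is extended-real-valued: for an unbounded input the numerator is \<open>\<infinity>\<close>.
  It is only meaningful for a nonzero input, where the infimum is over a nonempty set.\<close>

definition IDR :: "(nat \<Rightarrow> real) \<Rightarrow> ereal" where
  "IDR u =
    (let lo = (INF t\<in>{t. 1 \<le> t \<and> u t \<noteq> 0}. ereal \<bar>u t\<bar>);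
         hi = (SUP t\<in>{1..}. ereal \<bar>u t\<bar>)
     in if lo = 0 then \<infinity> else hi / lo)"

text \<open>The matrix \<open>B\<close> has a single column; \<open>vec 1\<close> embeds the scalar input as a one-dimensional vector.\<close>

primrec state :: "real mat \<Rightarrow> real mat \<Rightarrow> (nat \<Rightarrow> real) \<Rightarrow> nat \<Rightarrow> real vec" where
  "state A B u 0 = 0\<^sub>v (dim_row A)"
| "state A B u (Suc t) = A *\<^sub>v state A B u t + B *\<^sub>v vec 1 (\<lambda>_. u (Suc t))"

definition norm2 :: "real vec \<Rightarrow> real" where
  "norm2 v = L2_set (\<lambda>i. v $ i) {..<dim_vec v}"

definition stabilizes :: "real mat \<Rightarrow> real mat \<Rightarrow> (nat \<Rightarrow> real) \<Rightarrow> bool" where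
  "stabilizes A B u \<longleftrightarrow> (\<lambda>t. norm2 (state A B u t)) \<longlonglongrightarrow> 0"

text \<open>The class of systems under consideration; diagonal entries and entries of \<open>B\<close> are
  indexed by \<open>0, \<dots>, k - 1\<close>.\<close>

definition unstable_diagonal_system :: "real \<Rightarrow> nat \<Rightarrow> real mat \<Rightarrow> real mat \<Rightarrow> bool" where
  "unstable_diagonal_system \<eta> k A B \<longleftrightarrow>
     (\<exists>d :: nat \<Rightarrow> real. A = mat_diag k d \<and> inj_on d {..<k} \<and> (\<forall>i<k. 1 + \<eta> \<le> \<bar>d i\<bar>)) \<and>
     B \<in> carrier_mat k 1 \<and> (\<forall>i<k. B $$ (i, 0) \<noteq> 0)"

end

theory Submission
  imports Defs "HOL-Complex_Analysis.Conformal_Mappings"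
begin

text \<open>
  If the input dynamic range is finite, then \<open>u\<close> has finite support, because \<open>u\<close> tends to \<open>0\<close> while
  its nonzero values are bounded away from \<open>0\<close>. Dividing the state coordinates by \<open>\<lambda>\<^sub>i ^ t\<close> shows that
  the generating polynomial \<open>\<Sum>s. u\<^sub>s z ^ s\<close> vanishes at the points \<open>1 / \<lambda>\<^sub>i\<close>, all of modulus at
  most \<open>1 / (1 + \<eta>)\<close>. Jensen's inequality on the circle of radius \<open>r = (1 + \<eta>/2) / (1 + \<eta>)\<close>, after
  removing the zero at the origin, bounds the first nonzero coefficient times \<open>(1 + \<eta>/2) ^ k\<close> by
  the maximum of the polynomial on that circle, which is at most \<open>sup \<bar>u\<bar> / (1 - r)\<close>.
\<close>

section \<open>Jensen's inequality for polynomials and the resulting coefficient bound\<close>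

lemma poly_maximum_modulus_at_0:
  fixes p :: "complex poly"
  assumes r: "r > 0" and bound: "\<And>w. cmod w = r \<Longrightarrow> cmod (poly p w) \<le> C"
  shows "cmod (poly p 0) \<le> C"
proof (rule maximum_modulus_frontier[where f = "poly p" and S = "ball 0 r"])
  show "poly p holomorphic_on interior (ball 0 r)"
    by (rule holomorphic_on_subset[OF poly_holomorphic_on]) auto
  show "continuous_on (closure (ball 0 r)) (poly p)"
    by (intro continuous_intros)
  show "cmod (poly p z) \<le> C" if "z \<in> frontier (ball 0 r)" for z
    using that r bound by (simp add: frontier_ball)
qed (use r in auto)

text \<open>Induction over the roots: treating one root \<open>a\<close> keeps the modulus on the
  circle and multiplies the modulus at \<open>0\<close> by \<open>r / cmod a\<close>. Once all roots
  are used up, the maximum modulus principle concludes.\<close>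

lemma jensen_inequality_poly:
  fixes p :: "complex poly"
  assumes "finite Z" and r: "r > 0"
    and "\<And>z. z \<in> Z \<Longrightarrow> poly p z = 0" and "0 \<notin> Z"
    and "\<And>w. cmod w = r \<Longrightarrow> cmod (poly p w) \<le> C"
  shows "cmod (poly p 0) * (\<Prod>z\<in>Z. r / cmod z) \<le> C"
  using assms(1,3-5)
proof (induction Z arbitrary: p rule: finite_induct)
  case empty
  then show ?case using poly_maximum_modulus_at_0[OF r] by simp
next
  case (insert a Z)
  have a: "a \<noteq> 0" using insert.prems by auto
  from insert.prems(1)[of a] obtain q where q: "p = [:-a, 1:] * q"
    by (metis insertI1 poly_eq_0_iff_dvd dvdE)
  \<comment> \<open>Multiplication by a Blaschke factor replaces the root \<open>a\<close> by its reflection in the circle.\<close>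
  define p' where "p' = smult (1 / of_real r) ([:(of_real r)\<^sup>2, - cnj a:] * q)"
  have "cmod (poly p' 0) * (\<Prod>z\<in>Z. r / cmod z) \<le> C"
  proof (rule insert.IH)
    show "poly p' z = 0" if "z \<in> Z" for z
    proof -
      have "poly p z = 0" "z \<noteq> a" using that insert by auto
      then show ?thesis by (simp add: q p'_def)
    qed
    show "0 \<notin> Z" using insert.prems by auto
    show "cmod (poly p' w) \<le> C" if w: "cmod w = r" for w
    proof -
      \<comment> \<open>On the circle, \<open>r^2\<close> equals \<open>w * cnj w\<close>; hence the
        new factor, scaled by \<open>1 / r\<close>, has the modulus of \<open>w - a\<close>.\<close>
      have "(of_real r)\<^sup>2 - w * cnj a = w * cnj (w - a)"
        using complex_norm_square[of w] w by (simp add: algebra_simps)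
      then have "cmod ((of_real r)\<^sup>2 - w * cnj a) = r * cmod (w - a)"
        by (metis complex_mod_cnj norm_mult w)
      moreover have "poly p' w = 1 / of_real r * (((of_real r)\<^sup>2 - w * cnj a) * poly q w)"
        by (simp add: p'_def algebra_simps)
      moreover have "poly p w = (w - a) * poly q w"
        by (simp add: q algebra_simps)
      ultimately have "cmod (poly p' w) = cmod (poly p w)"
        using r by (simp add: norm_mult norm_divide del: mult_1)
      with insert.prems(3)[OF w] show ?thesis by simp
    qed
  qed
  moreover have "cmod (poly p' 0) = cmod (poly p 0) * (r / cmod a)"
    using r a by (simp add: q p'_def norm_mult norm_divide power2_eq_square)
  ultimately show ?case
    using insert.hyps by (simp add: mult.assoc)
qed

lemma polynomial_roots_coeff_ratio:
  fixes v :: "nat \<Rightarrow> real" and d :: "nat \<Rightarrow> real"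
  assumes \<eta>: "\<eta> > 0" and inj: "inj_on d {..<k}" and d: "\<And>i. i < k \<Longrightarrow> 1 + \<eta> \<le> \<bar>d i\<bar>"
    and root: "\<And>i. i < k \<Longrightarrow> (\<Sum>s<N. v s / d i ^ s) = 0"
    and M: "\<And>s. \<bar>v s\<bar> \<le> M" and N: "N > 0"
  shows "\<bar>v 0\<bar> * (\<eta> / (2 * (1 + \<eta>)) * (1 + \<eta> / 2) ^ k) \<le> M"
proof -
  \<comment> \<open>The midpoint of \<open>1 / (1 + \<eta>)\<close> and \<open>1\<close>: below
    \<open>1\<close>, so the geometric series is bounded by \<open>1 / (1 - r)\<close>, yet large
    enough that each root \<open>1 / d i\<close> contributes
    \<open>r * \<bar>d i\<bar> \<ge> 1 + \<eta> / 2\<close>.\<close>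
  define r where "r = (1 + \<eta> / 2) / (1 + \<eta>)"
  have r0: "r > 0" and r1: "r < 1" using \<eta> by (auto simp: r_def field_simps)
  have r_compl: "1 - r = \<eta> / (2 * (1 + \<eta>))" using \<eta> by (simp add: r_def field_simps)
  have M0: "M \<ge> 0" using M[of 0] by simp
  define p :: "complex poly" where "p = (\<Sum>s<N. monom (of_real (v s)) s)"
  have p_eval: "poly p w = (\<Sum>s<N. of_real (v s) * w ^ s)" for w
    by (simp add: p_def poly_sum poly_monom)
  define g :: "nat \<Rightarrow> complex" where "g i = of_real (1 / d i)" for i
  have d0: "d i \<noteq> 0" if "i < k" for i using d[OF that] \<eta> by auto
  \<comment> \<open>Distinct diagonal entries give \<open>k\<close> distinct roots, hence
    \<open>k\<close> factors in the product.\<close>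
  have inj_g: "inj_on g {..<k}"
    using inj by (auto simp: inj_on_def g_def)
  have "cmod (poly p 0) * (\<Prod>z\<in>g ` {..<k}. r / cmod z) \<le> M / (1 - r)"
  proof (rule jensen_inequality_poly[OF _ r0])
    show "poly p z = 0" if "z \<in> g ` {..<k}" for z
    proof -
      from that obtain i where i: "i < k" "z = g i" by auto
      have "poly p z = of_real (\<Sum>s<N. v s / d i ^ s)"
        by (simp add: p_eval i g_def power_divide)
      with root[OF i(1)] show ?thesis by simp
    qed
    show "0 \<notin> g ` {..<k}" using d0 by (auto simp: g_def)
    show "cmod (poly p w) \<le> M / (1 - r)" if w: "cmod w = r" for w
    proof -
      have "cmod (poly p w) \<le> (\<Sum>s<N. \<bar>v s\<bar> * r ^ s)"
        unfolding p_eval by (rule order_trans[OF norm_sum]) (simp add: norm_mult norm_power w)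
      also have "\<dots> \<le> (\<Sum>s<N. M * r ^ s)"
        using M r0 by (intro sum_mono mult_right_mono) auto
      also have "\<dots> = M * ((1 - r ^ N) / (1 - r))"
        using r1 by (simp add: sum_distrib_left[symmetric] sum_gp_strict)
      also have "\<dots> \<le> M * (1 / (1 - r))"
        using M0 r0 r1 by (intro mult_left_mono divide_right_mono) auto
      finally show ?thesis by simp
    qed
  qed simp
  moreover have "(\<Prod>z\<in>g ` {..<k}. r / cmod z) = (\<Prod>i<k. r * \<bar>d i\<bar>)"
    unfolding prod.reindex[OF inj_g] by (simp add: g_def norm_divide)
  moreover have "cmod (poly p 0) = \<bar>v 0\<bar>"
    using N by (simp add: p_eval power_0_left sum.delta if_distrib cong: if_cong)
  ultimately have jensen: "\<bar>v 0\<bar> * (\<Prod>i<k. r * \<bar>d i\<bar>) \<le> M / (1 - r)"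
    by simp
  have "(1 + \<eta> / 2) ^ k = (\<Prod>i<k. 1 + \<eta> / 2)" by simp
  also have "\<dots> \<le> (\<Prod>i<k. r * \<bar>d i\<bar>)"
  proof (rule prod_mono, intro conjI)
    fix i assume "i \<in> {..<k}"
    then have "r * (1 + \<eta>) \<le> r * \<bar>d i\<bar>" using d r0 by (intro mult_left_mono) auto
    then show "1 + \<eta> / 2 \<le> r * \<bar>d i\<bar>" using \<eta> by (simp add: r_def)
  qed (use \<eta> in simp)
  finally have "\<bar>v 0\<bar> * (1 + \<eta> / 2) ^ k \<le> M / (1 - r)"
    using jensen by (meson abs_ge_zero mult_left_mono order_trans)
  then show ?thesis
    using r1 unfolding r_compl[symmetric] by (simp add: field_simps)
qed

section \<open>State coordinates of a diagonal system\<close>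

lemma dim_row_mat_diag [simp]: "dim_row (mat_diag k d) = k"
  by (simp add: mat_diag_def)

lemma dim_state: "B \<in> carrier_mat (dim_row A) 1 \<Longrightarrow> dim_vec (state A B u t) = dim_row A"
  by (induction t) auto

lemma state_diag_Suc:
  assumes "B \<in> carrier_mat k 1" and "i < k"
  shows "state (mat_diag k d) B u (Suc t) $ i =
    d i * state (mat_diag k d) B u t $ i + B $$ (i, 0) * u (Suc t)"
proof -
  define x where "x = state (mat_diag k d) B u t"
  have "dim_vec x = k" using assms dim_state[of B "mat_diag k d"] by (simp add: x_def)
  then have "(mat_diag k d *\<^sub>v x) $ i = (\<Sum>j<k. (if i = j then d j else 0) * x $ j)"
    using assms by (simp add: scalar_prod_def mat_diag_def lessThan_atLeast0)
  also have "\<dots> = (\<Sum>j<k. if i = j then d j * x $ j else 0)"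
    by (intro sum.cong) auto
  also have "\<dots> = d i * x $ i"
    using assms by simp
  finally show ?thesis
    using assms by (simp add: scalar_prod_def flip: x_def)
qed

lemma state_diag_normalized:
  assumes "B \<in> carrier_mat k 1" and "i < k" and "d i \<noteq> 0"
  shows "state (mat_diag k d) B u t $ i = B $$ (i, 0) * d i ^ t * (\<Sum>s=1..t. u s / d i ^ s)"
proof (induction t)
  case 0
  then show ?case using assms by simp
next
  case (Suc t)
  then show ?case
    using assms by (simp add: state_diag_Suc field_simps del: state.simps)
qed

lemma stabilizes_component:
  assumes "stabilizes A B u" and "B \<in> carrier_mat (dim_row A) 1" and "i < dim_row A"
  shows "(\<lambda>t. state A B u t $ i) \<longlonglongrightarrow> 0"
proof (rule Lim_null_comparison)
  show "(\<lambda>t. norm2 (state A B u t)) \<longlonglongrightarrow> 0"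
    using assms(1) by (simp add: stabilizes_def)
  have "\<bar>state A B u t $ i\<bar> \<le> norm2 (state A B u t)" for t
  proof -
    have "\<bar>x $ i\<bar> \<le> norm2 x" if "i < dim_vec x" for x :: "real Matrix.vec"
    proof -
      have "\<bar>x $ i\<bar> \<le> L2_set (\<lambda>i. \<bar>x $ i\<bar>) {..<dim_vec x}"
        using that by (intro member_le_L2_set) auto
      also have "\<dots> = norm2 x" by (simp add: norm2_def L2_set_def)
      finally show ?thesis .
    qed
    then show ?thesis using assms dim_state[of B A] by simp
  qed
  then show "\<forall>\<^sub>F t in sequentially. norm (state A B u t $ i) \<le> norm2 (state A B u t)"
    by simp
qed

text \<open>Solving the recursion for the input expresses \<open>u (Suc t)\<close> through two
  consecutive values of one state coordinate, both tending to \<open>0\<close>.\<close>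

lemma stabilizing_input_tendsto_0:
  assumes stab: "stabilizes (mat_diag k d) B u" and B: "B \<in> carrier_mat k 1"
    and i: "i < k" and b: "B $$ (i, 0) \<noteq> 0"
  shows "u \<longlonglongrightarrow> 0"
proof -
  let ?x = "\<lambda>t. state (mat_diag k d) B u t $ i"
  have lim: "?x \<longlonglongrightarrow> 0" using stabilizes_component[OF stab] B i by simp
  have "(\<lambda>t. (?x (Suc t) - d i * ?x t) / B $$ (i, 0)) \<longlonglongrightarrow> (0 - d i * 0) / B $$ (i, 0)"
    using b by (intro tendsto_intros lim LIMSEQ_Suc[OF lim])
  also have "(\<lambda>t. (?x (Suc t) - d i * ?x t) / B $$ (i, 0)) = (\<lambda>t. u (Suc t))"
    using b state_diag_Suc[OF B i] by (simp del: state.simps)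
  finally show ?thesis by (simp add: LIMSEQ_imp_Suc)
qed

text \<open>From time \<open>T\<close> on the normalized sum is frozen, and
  \<open>\<bar>d i\<bar> ^ t \<ge> 1\<close> keeps the coordinate at least as large as
  \<open>B $$ (i, 0)\<close> times that sum in modulus. It can tend to \<open>0\<close> only if the
  sum vanishes.\<close>

lemma stabilizing_finite_input_root:
  assumes stab: "stabilizes (mat_diag k d) B u" and B: "B \<in> carrier_mat k 1"
    and i: "i < k" and b: "B $$ (i, 0) \<noteq> 0" and d: "\<bar>d i\<bar> \<ge> 1"
    and supp: "\<And>t. t > T \<Longrightarrow> u t = 0"
  shows "(\<Sum>s=1..T. u s / d i ^ s) = 0"
proof -
  let ?S = "\<Sum>s=1..T. u s / d i ^ s"
  let ?x = "\<lambda>t. state (mat_diag k d) B u t $ i"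
  have "?x \<longlonglongrightarrow> 0" using stabilizes_component[OF stab] B i by simp
  then have "(\<lambda>t. \<bar>?x t\<bar>) \<longlonglongrightarrow> 0" by (simp add: tendsto_rabs_zero)
  moreover have "\<bar>B $$ (i, 0) * ?S\<bar> \<le> \<bar>?x t\<bar>" if "t \<ge> T" for t
  proof -
    have "(\<Sum>s=1..t. u s / d i ^ s) = ?S"
      using that supp by (intro sum.mono_neutral_right) auto
    then have "\<bar>?x t\<bar> = \<bar>B $$ (i, 0) * ?S\<bar> * \<bar>d i\<bar> ^ t"
      using state_diag_normalized[OF B i, of d u t] d by (simp add: abs_mult power_abs)
    moreover have "\<bar>B $$ (i, 0) * ?S\<bar> * 1 \<le> \<bar>B $$ (i, 0) * ?S\<bar> * \<bar>d i\<bar> ^ t"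
      using d by (intro mult_left_mono one_le_power) auto
    ultimately show ?thesis by simp
  qed
  ultimately have "\<bar>B $$ (i, 0) * ?S\<bar> \<le> 0"
    by (intro LIMSEQ_le_const) auto
  with b show ?thesis by simp
qed

section \<open>Amplitude bound and dynamic range\<close>

lemma stabilizing_input_amplitude:
  assumes \<eta>: "\<eta> > 0" and k: "k \<ge> 1" and sys: "unstable_diagonal_system \<eta> k A B"
    and nz: "nonzero_input u" and stab: "stabilizes A B u"
    and l: "l > 0" "\<And>t. t \<ge> 1 \<Longrightarrow> u t \<noteq> 0 \<Longrightarrow> l \<le> \<bar>u t\<bar>"
    and M: "\<And>t. t \<ge> 1 \<Longrightarrow> \<bar>u t\<bar> \<le> M"
  shows "l * (\<eta> / (2 * (1 + \<eta>)) * (1 + \<eta> / 2) ^ k) \<le> M"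
proof -
  obtain d where A: "A = mat_diag k d" and inj: "inj_on d {..<k}"
    and d: "\<And>i. i < k \<Longrightarrow> 1 + \<eta> \<le> \<bar>d i\<bar>"
    and B: "B \<in> carrier_mat k 1" and b: "\<And>i. i < k \<Longrightarrow> B $$ (i, 0) \<noteq> 0"
    using sys unfolding unstable_diagonal_system_def by blast
  note stab = stab[unfolded A]
  have "u \<longlonglongrightarrow> 0" using stabilizing_input_tendsto_0[OF stab B, of 0] b k by simp
  then obtain T where T: "\<And>t. t \<ge> T \<Longrightarrow> \<bar>u t\<bar> < l"
    using LIMSEQ_D[of u 0 l] l(1) by auto
  have supp: "u t = 0" if "t > T" for t
    using T[of t] l(2)[of t] that by force
  \<comment> \<open>Dividing the generating polynomial by \<open>z ^ m\<close> makes the constant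
    coefficient \<open>u m\<close>, of modulus at least \<open>l\<close>.\<close>
  define m where "m = (LEAST t. 1 \<le> t \<and> u t \<noteq> 0)"
  have m: "1 \<le> m" "u m \<noteq> 0"
    using nz LeastI_ex[of "\<lambda>t. 1 \<le> t \<and> u t \<noteq> 0"] unfolding m_def nonzero_input_def by auto
  have before_m: "u t = 0" if "1 \<le> t" "t < m" for t
    using not_less_Least[of t "\<lambda>t. 1 \<le> t \<and> u t \<noteq> 0"] that unfolding m_def by auto
  have mT: "m \<le> T" using supp[of m] m(2) not_le by blast
  \<comment> \<open>The form \<open>m + 0\<close> matches \<open>v 0\<close> in the rule, with
    \<open>v s\<close> being \<open>u (m + s)\<close>.\<close>
  have "\<bar>u (m + 0)\<bar> * (\<eta> / (2 * (1 + \<eta>)) * (1 + \<eta> / 2) ^ k) \<le> M"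
  proof (rule polynomial_roots_coeff_ratio[OF \<eta> inj d, where N = "Suc T - m"])
    show "(\<Sum>s<Suc T - m. u (m + s) / d i ^ s) = 0" if i: "i < k" for i
    proof -
      have d0: "d i \<noteq> 0" using d[OF i] \<eta> by auto
      have "0 = (\<Sum>s=1..T. u s / d i ^ s)"
        using stabilizing_finite_input_root[OF stab B i b[OF i] _ supp] d[OF i] \<eta> by simp
      also have "\<dots> = (\<Sum>s=m..T. u s / d i ^ s)"
        using m before_m by (intro sum.mono_neutral_right) auto
      also have "\<dots> = (\<Sum>s<Suc T - m. u (m + s) / d i ^ (m + s))"
        using mT by (intro sum.reindex_bij_witness[of _ "\<lambda>s. m + s" "\<lambda>s. s - m"]) auto
      also have "\<dots> = (\<Sum>s<Suc T - m. u (m + s) / d i ^ s) / d i ^ m"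
        by (simp add: sum_divide_distrib power_add mult.commute)
      finally show ?thesis using d0 by simp
    qed
  qed (use m mT M in auto)
  moreover have "l * (\<eta> / (2 * (1 + \<eta>)) * (1 + \<eta> / 2) ^ k)
      \<le> \<bar>u (m + 0)\<bar> * (\<eta> / (2 * (1 + \<eta>)) * (1 + \<eta> / 2) ^ k)"
    using l(2)[of m] m \<eta> by (intro mult_right_mono) auto
  ultimately show ?thesis by linarith
qed

text \<open>If \<open>lo\<close> is \<open>0\<close> or \<open>hi\<close> is infinite, the range is
  infinite and the bound is trivial; otherwise both are real and the amplitude bound is divided by
  \<open>lo\<close>.\<close>

lemma IDR_lower_bound:
  assumes \<eta>: "\<eta> > 0" and k: "k \<ge> 1" and sys: "unstable_diagonal_system \<eta> k A B"
    and nz: "nonzero_input u" and stab: "stabilizes A B u"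
  shows "IDR u \<ge> ereal (\<eta> / (2 * (1 + \<eta>)) * (1 + \<eta> / 2) ^ k)"
proof -
  let ?c = "\<eta> / (2 * (1 + \<eta>)) * (1 + \<eta> / 2) ^ k"
  define lo where "lo = (INF t\<in>{t. 1 \<le> t \<and> u t \<noteq> 0}. ereal \<bar>u t\<bar>)"
  define hi where "hi = (SUP t\<in>{1..}. ereal \<bar>u t\<bar>)"
  have IDR: "IDR u = (if lo = 0 then \<infinity> else hi / lo)"
    by (simp add: IDR_def lo_def hi_def Let_def)
  obtain t0 where t0: "t0 \<ge> 1" "u t0 \<noteq> 0" using nz by (auto simp: nonzero_input_def)
  have lo_le: "lo \<le> ereal \<bar>u t\<bar>" if "t \<ge> 1" "u t \<noteq> 0" for t
    unfolding lo_def using that by (intro INF_lower) auto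
  have le_hi: "ereal \<bar>u t\<bar> \<le> hi" if "t \<ge> 1" for t
    unfolding hi_def using that by (intro SUP_upper) auto
  have "lo \<ge> 0" unfolding lo_def by (intro INF_greatest) auto
  \<comment> \<open>The nonzero value at \<open>t0\<close> keeps the infimum finite.\<close>
  then consider "lo = 0" | l where "lo = ereal l" "l > 0"
    using lo_le[OF t0] by (cases lo) (auto simp: le_less)
  then show ?thesis
  proof cases
    case 1
    then show ?thesis by (simp add: IDR)
  next
    case 2
    show ?thesis
    proof (cases hi)
      case (real M)
      have "l * ?c \<le> M"
        using lo_le le_hi 2 real
        by (intro stabilizing_input_amplitude[OF \<eta> k sys nz stab]) auto
      then show ?thesis using 2 real by (simp add: IDR field_simps)
    next
      case PInf
      then show ?thesis using 2 by (simp add: IDR)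
    next
      case MInf
      then show ?thesis using le_hi[OF t0(1)] by simp
    qed
  qed
qed

theorem proposition9:
  fixes \<eta> :: real
  assumes "\<eta> > 0"
  shows "(\<forall>k A B u. k \<ge> 1 \<longrightarrow> unstable_diagonal_system \<eta> k A B \<longrightarrow>
            nonzero_input u \<longrightarrow> stabilizes A B u \<longrightarrow>
            IDR u \<ge> ereal (\<eta> / (2 * (1 + \<eta>)) * (1 + \<eta> / 2) ^ k))
       \<and> (\<exists>c>0. \<exists>r>1. \<forall>k A B u. k \<ge> 1 \<longrightarrow> unstable_diagonal_system \<eta> k A B \<longrightarrow>
            nonzero_input u \<longrightarrow> stabilizes A B u \<longrightarrow>
            IDR u \<ge> ereal (c * r ^ k))"
proof -
  \<comment> \<open>These are the witnesses \<open>c\<close> and \<open>r\<close> for exponential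
    growth; they depend on \<open>\<eta>\<close> alone.\<close>
  have "\<eta> / (2 * (1 + \<eta>)) > 0" "1 + \<eta> / 2 > 1" using assms by auto
  then show ?thesis using IDR_lower_bound[OF assms] by blast
qed

end
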